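(* Let $D$ be a domain in $\mathbb{R}^N$, $N\geq2$, and let $K,K_1,K_2\geq1$. (i) If $u:D\to[-\infty,+\infty)$ is $K_1$-quasi-nearly subharmonic and $K_2\geq K_1$, then $u$ is $K_2$-quasi-nearly subharmonic in $D$. (ii) If $u_1:D\to[-\infty,+\infty)$ and $u_2:D\to[-\infty,+\infty)$ are $K$-quasi-nearly subharmonic n.s., then $\lambda_1u_1+\lambda_2u_2$ is $K$-quasi-nearly subharmonic n.s. in $D$ for all $\lambda_1,\lambda_2\geq0$. (iii) If $u:D\to[-\infty,+\infty)$ is quasi-nearly subharmonic, then $u$ is locally bounded above in $D$. (iv) If $u_j:D\to[-\infty,+\infty)$, $j=1,2,\dots$, are $K$-quasi-nearly subharmonic (resp. $K$-quasi-nearly subharmonic n.s.), and $u_j\searrow u$ as $j\to+\infty$, then $u$ is $K$-quasi-nearly subharmonic (resp. $K$-quasi-nearly subharmonic n.s.) in $D$. (v) If $u:D\to[-\infty,+\infty)$ is $K_1$-quasi-nearly subharmonic and $v:D\to[-\infty,+\infty)$ is $K_2$-quasi-nearly subharmonic, then $\max\{u,v\}$ is $\max\{K_1,K_2\}$-quasi-nearly subharmonic in $D$. Especially, $u^+:=\max\{u,0\}$ is $K_1$-quasi-nearly subharmonic in $D$. (vi) Let $\mathcal{F}$ be a family of $K$-quasi-nearly subharmonic (resp. $K$-quasi-nearly subharmonic n.s.) functions in $D$ and let $w:=\sup_{u\in\mathcal{F}}u$. If $w$ is Lebesgue measurable and $w^+\in\mathcal{L}^1_{\mathrm{loc}}(D)$,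 then $w$ is $K$-quasi-nearly subharmonic (resp. $K$-quasi-nearly subharmonic n.s.) in $D$. (vii) If $u:D\to[-\infty,+\infty)$ is quasi-nearly subharmonic n.s., then either $u\equiv-\infty$ or $u$ is finite almost everywhere in $D$, and $u\in\mathcal{L}^1_{\mathrm{loc}}(D)$.
   Context: $m_N$ is Lebesgue measure on $\mathbb{R}^N$, $B^N(x,r)$ the open ball, $\nu_N=m_N(B^N(0,1))$, and $u^+=\max\{u,0\}$. The convention $0\cdot(-\infty)=0$ is used. In (vii), the second alternative consists of both assertions ($u$ finite almost everywhere and $u\in\mathcal{L}^1_{\mathrm{loc}}(D)$). Let $D\subset\mathbb{R}^N$ be a domain, $N\ge2$, and $K\geq1$. A Lebesgue measurable function $u:D\to[-\infty,+\infty)$ with $u^+\in\mathcal{L}^1_{\mathrm{loc}}(D)$ is: - $K$-quasi-nearly subharmonic if for all $M\geq 0$ and all closed balls $\overline{B^N(x,r)}\subset D$, $u_M(x)\leq\frac{K}{\nu_N r^N}\int_{B^N(x,r)}u_M\,dm_N$, where $u_M:=\max\{u,-M\}+M$; - $K$-quasi-nearly subharmonic n.s. (in the narrow sense) if for all $\overline{B^N(x,r)}\subset D$, $u(x)\leq\frac{K}{\nu_N r^N}\int_{B^N(x,r)}u\,dm_N$. It is quasi-nearly subharmonic (resp. quasi-nearly subharmonic n.s.) if it is so with some constant $K\geq1$. *)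

theory Defs
  imports "HOL-Analysis.Analysis"
begin

text \<open>
  A function \<open>D \<rightarrow> [-\<infinity>, +\<infinity>)\<close> is a total \<open>ereal\<close>-valued function of which only the values on
  \<open>D\<close> matter. In \<open>ereal\<close> one has \<open>0 * (-\<infinity>) = 0\<close>.
\<close>

text \<open>
  The Lebesgue integral of an extended real-valued function, as the integral of the positive part
  minus the integral of the negative part; \<^const>\<open>e2ennreal\<close> sends negative numbers to \<open>0\<close>.
  The value is meaningful only if one of the two integrals is finite
  (\<open>\<infinity> - \<infinity> = \<infinity>\<close> in \<open>ereal\<close>). Below, the integral of the positive part is always finite.
\<close>
definition ereal_integral :: "'a measure \<Rightarrow> ('a \<Rightarrow> ereal) \<Rightarrow> ereal" where
  "ereal_integral M f =
     enn2ereal (\<integral>\<^sup>+x. e2ennreal (f x) \<partial>M) - enn2ereal (\<integral>\<^sup>+x. e2ennreal (- f x) \<partial>M)"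

definition locally_integrable :: "'a::euclidean_space set \<Rightarrow> ('a \<Rightarrow> ereal) \<Rightarrow> bool" where
  "locally_integrable D f \<longleftrightarrow>
     f \<in> borel_measurable (lebesgue_on D) \<and>
     (\<forall>C. compact C \<and> C \<subseteq> D \<longrightarrow> (\<integral>\<^sup>+x. e2ennreal \<bar>f x\<bar> \<partial>(lebesgue_on C)) < \<infinity>)"

definition locally_bounded_above :: "'a::euclidean_space set \<Rightarrow> ('a \<Rightarrow> ereal) \<Rightarrow> bool" where
  "locally_bounded_above D u \<longleftrightarrow>
     (\<forall>x\<in>D. \<exists>e>0. \<exists>C::real. \<forall>y\<in>ball x e \<inter> D. u y \<le> ereal C)"

definition pos_part :: "('a \<Rightarrow> ereal) \<Rightarrow> 'a \<Rightarrow> ereal" where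
  "pos_part u = (\<lambda>x. max (u x) 0)"

definition trunc :: "real \<Rightarrow> ('a \<Rightarrow> ereal) \<Rightarrow> 'a \<Rightarrow> ereal" where
  "trunc M u = (\<lambda>x. max (u x) (- ereal M) + ereal M)"

definition admissible :: "'a::euclidean_space set \<Rightarrow> ('a \<Rightarrow> ereal) \<Rightarrow> bool" where
  "admissible D u \<longleftrightarrow>
     (\<forall>x\<in>D. u x < \<infinity>) \<and>
     u \<in> borel_measurable (lebesgue_on D) \<and>
     locally_integrable D (pos_part u)"

definition qns_mean :: "real \<Rightarrow> ('a::euclidean_space \<Rightarrow> ereal) \<Rightarrow> 'a \<Rightarrow> real \<Rightarrow> ereal" where
  "qns_mean K u x r =
     ereal (K / (measure lebesgue (ball (0::'a) 1) * r ^ DIM('a)))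
       * ereal_integral (lebesgue_on (ball x r)) u"

definition K_qns :: "real \<Rightarrow> 'a::euclidean_space set \<Rightarrow> ('a \<Rightarrow> ereal) \<Rightarrow> bool" where
  "K_qns K D u \<longleftrightarrow>
     admissible D u \<and>
     (\<forall>M\<ge>0. \<forall>x r. 0 < r \<and> cball x r \<subseteq> D \<longrightarrow> trunc M u x \<le> qns_mean K (trunc M u) x r)"

definition K_qns_ns :: "real \<Rightarrow> 'a::euclidean_space set \<Rightarrow> ('a \<Rightarrow> ereal) \<Rightarrow> bool" where
  "K_qns_ns K D u \<longleftrightarrow>
     admissible D u \<and>
     (\<forall>x r. 0 < r \<and> cball x r \<subseteq> D \<longrightarrow> u x \<le> qns_mean K u x r)"

definition quasi_nearly_subharmonic :: "'a::euclidean_space set \<Rightarrow> ('a \<Rightarrow> ereal) \<Rightarrow> bool" where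
  "quasi_nearly_subharmonic D u \<longleftrightarrow> (\<exists>K\<ge>1. K_qns K D u)"

definition quasi_nearly_subharmonic_ns :: "'a::euclidean_space set \<Rightarrow> ('a \<Rightarrow> ereal) \<Rightarrow> bool" where
  "quasi_nearly_subharmonic_ns D u \<longleftrightarrow> (\<exists>K\<ge>1. K_qns_ns K D u)"

end

theory Submission imports Defs begin

text \<open>
  Every part is a property of the inequality \<open>u x \<le> (K / |B|) \<integral>\<^sub>B u\<close>, in which \<open>u\<^sup>+\<close> is integrable on each
  ball \<open>B\<close>, so that the integral exists in \<open>[-\<infinity>, \<infinity>)\<close>.

  On measurable functions without the value \<open>\<infinity>\<close> and with integrable positive part, the integral is monotone, additive, positively
  homogeneous and continuous along decreasing sequences (\<open>ereal_integral_mono\<close>, \<open>ereal_integral_add\<close>,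
  \<open>ereal_integral_cmult\<close>, \<open>ereal_integral_decreasing_limit\<close>). Additivity and homogeneity give the linear
  combinations, continuity gives the decreasing limits, and monotonicity gives maxima and suprema: each
  competitor is bounded by the mean value of the larger function. Enlarging the constant is harmless for
  truncations because these are nonnegative. A quasi-nearly subharmonic function is locally bounded
  above because the mean values of \<open>u\<^sup>+\<close> over balls of a fixed radius around nearby points are all bounded by
  a fixed multiple of the integral of \<open>u\<^sup>+\<close> over one compact ball.

  For the last part, a point \<open>y\<close> with \<open>u y > -\<infinity>\<close> has \<open>\<integral>\<^sub>B u > -\<infinity>\<close> for all balls \<open>B\<close> centred
  at \<open>y\<close> with closure in \<open>D\<close>. So a point of \<open>D\<close> either has a neighbourhood
  on which \<open>u = -\<infinity>\<close>, or is so close to such a \<open>y\<close> that \<open>u\<close> is integrable around it. Both conditions are open and they exclude each other, so by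
  connectedness one of them holds on the whole of \<open>D\<close>. In the second case, compact sets are covered by
  finitely many balls of integrability, and \<open>D\<close> is a countable union of compact sets, on each of
  which \<open>u\<close> is finite almost everywhere.
\<close>

section \<open>Integrals of extended real functions\<close>

lemma e2ennreal_pos_part [simp]: "e2ennreal (max x 0) = e2ennreal x"
  by (simp add: max_def e2ennreal_neg)

lemma ereal_integral_nonneg:
  assumes "\<And>x. x \<in> space M \<Longrightarrow> 0 \<le> f x"
  shows "ereal_integral M f = enn2ereal (\<integral>\<^sup>+x. e2ennreal (f x) \<partial>M)"
proof -
  have "(\<integral>\<^sup>+x. e2ennreal (- f x) \<partial>M) = (\<integral>\<^sup>+x. 0 \<partial>M)"
    by (intro nn_integral_cong) (simp add: assms e2ennreal_neg)
  then show ?thesis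
    by (simp add: ereal_integral_def zero_ennreal.rep_eq)
qed

lemma ereal_integral_mono:
  assumes "\<And>x. x \<in> space M \<Longrightarrow> f x \<le> g x"
  shows "ereal_integral M f \<le> ereal_integral M g"
  unfolding ereal_integral_def
  by (intro ereal_minus_mono; unfold less_eq_ennreal.rep_eq[symmetric])
     (auto intro!: nn_integral_mono e2ennreal_mono assms)

text \<open>
  No integrability is needed: if both halves are infinite, the left side is \<open>\<infinity> - \<infinity> = \<infinity>\<close>
  and so is the right side.
\<close>

lemma ereal_integral_le_pos:
  "ereal_integral M f \<le> enn2ereal (\<integral>\<^sup>+x. e2ennreal (f x) \<partial>M)"
  unfolding ereal_integral_def using ereal_minus_mono[OF order_refl enn2ereal_nonneg] by simp

text \<open>
  The identity \<open>(f + g)\<^sup>+ + f\<^sup>- + g\<^sup>- = (f + g)\<^sup>- + f\<^sup>+ + g\<^sup>+\<close>, free of subtractions. It also holds where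
  \<open>f\<close> or \<open>g\<close> is \<open>-\<infinity>\<close>, both sides being \<open>\<infinity>\<close> there. Integrating it gives additivity of the integral.
\<close>

lemma e2ennreal_add_split:
  assumes "f < \<infinity>" "g < \<infinity>"
  shows "e2ennreal (f + g) + (e2ennreal (- f) + e2ennreal (- g)) =
    e2ennreal (- (f + g)) + (e2ennreal f + e2ennreal g)"
proof (cases "\<exists>x y. f = ereal x \<and> g = ereal y")
  case True
  then obtain x y where xy: "f = ereal x" "g = ereal y"
    by blast
  consider "0 \<le> x" "0 \<le> y" | "x < 0" "y < 0" | "0 \<le> x" "y < 0" "0 \<le> x + y" | "0 \<le> x" "y < 0" "x + y < 0"
    | "x < 0" "0 \<le> y" "0 \<le> x + y" | "x < 0" "0 \<le> y" "x + y < 0"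
    by linarith
  then show ?thesis
    unfolding xy by cases (simp_all add: ennreal_neg flip: ennreal_plus minus_add_distrib)
next
  case False
  with assms have "f = -\<infinity> \<or> g = -\<infinity>"
    by (cases f; cases g) auto
  with assms show ?thesis
    by (cases f; cases g) auto
qed

lemma e2ennreal_add_le: "e2ennreal (f + g) \<le> e2ennreal f + e2ennreal g"
proof -
  have "e2ennreal (f + g) \<le> e2ennreal (max f 0 + max g 0)"
    by (intro e2ennreal_mono add_mono) auto
  also have "\<dots> = e2ennreal (max f 0) + e2ennreal (max g 0)"
    by (metis e2ennreal_enn2ereal enn2ereal_e2ennreal max.cobounded2 plus_ennreal.rep_eq)
  finally show ?thesis
    by simp
qed

lemma ereal_integral_add:
  assumes [measurable]: "f \<in> borel_measurable M" "g \<in> borel_measurable M"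
    and fin: "\<And>x. x \<in> space M \<Longrightarrow> f x < \<infinity>" "\<And>x. x \<in> space M \<Longrightarrow> g x < \<infinity>"
    and int: "(\<integral>\<^sup>+x. e2ennreal (f x) \<partial>M) < \<infinity>" "(\<integral>\<^sup>+x. e2ennreal (g x) \<partial>M) < \<infinity>"
  shows "ereal_integral M (\<lambda>x. f x + g x) = ereal_integral M f + ereal_integral M g"
proof -
  define P Q A A' B B' where
    "P = (\<integral>\<^sup>+x. e2ennreal (f x + g x) \<partial>M)" and "Q = (\<integral>\<^sup>+x. e2ennreal (- (f x + g x)) \<partial>M)" and
    "A = (\<integral>\<^sup>+x. e2ennreal (f x) \<partial>M)" and "A' = (\<integral>\<^sup>+x. e2ennreal (- f x) \<partial>M)" and
    "B = (\<integral>\<^sup>+x. e2ennreal (g x) \<partial>M)" and "B' = (\<integral>\<^sup>+x. e2ennreal (- g x) \<partial>M)"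
  note defs = this
  have "P + (A' + B') = (\<integral>\<^sup>+x. e2ennreal (f x + g x) + (e2ennreal (- f x) + e2ennreal (- g x)) \<partial>M)"
    unfolding defs by (simp add: nn_integral_add)
  also have "\<dots> = (\<integral>\<^sup>+x. e2ennreal (- (f x + g x)) + (e2ennreal (f x) + e2ennreal (g x)) \<partial>M)"
    by (intro nn_integral_cong e2ennreal_add_split fin)
  also have "\<dots> = Q + (A + B)"
    unfolding defs by (simp add: nn_integral_add)
  finally have eq: "P + (A' + B') = Q + (A + B)" .
  \<comment> \<open>\<open>A\<close>, \<open>B\<close> and hence \<open>P\<close> are finite, so they may be moved across the equation even if \<open>Q\<close>, \<open>A'\<close> or \<open>B'\<close> is infinite.\<close>
  have "P \<le> (\<integral>\<^sup>+x. e2ennreal (f x) + e2ennreal (g x) \<partial>M)"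
    unfolding defs by (intro nn_integral_mono e2ennreal_add_le)
  also have "\<dots> = A + B"
    unfolding defs by (simp add: nn_integral_add)
  finally have PAB: "P \<le> A + B" .
  have AB: "A < \<infinity>" "B < \<infinity>"
    using int by (simp_all add: defs)
  with PAB have "P < \<infinity>"
    by (simp add: less_top order.strict_trans1 top_unique)
  with AB eq have "enn2ereal P - enn2ereal Q = (enn2ereal A - enn2ereal A') + (enn2ereal B - enn2ereal B')"
    by (cases P; cases Q; cases A; cases A'; cases B; cases B')
       (auto simp flip: ennreal_plus simp: top_add)
  then show ?thesis
    by (simp add: ereal_integral_def defs)
qed

lemma e2ennreal_cmult:
  assumes "0 \<le> a"
  shows "e2ennreal (ereal a * x) = ennreal a * e2ennreal x"
proof (cases "0 \<le> x")
  case True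
  then have "ereal a * x = enn2ereal (ennreal a * e2ennreal x)"
    using assms by (simp add: times_ennreal.rep_eq enn2ereal_e2ennreal)
  then show ?thesis
    by simp
next
  case False
  with assms show ?thesis
    by (simp add: e2ennreal_neg ereal_mult_le_0_iff)
qed

lemma ereal_integral_cmult:
  assumes [measurable]: "f \<in> borel_measurable M"
    and "0 \<le> a" and "(\<integral>\<^sup>+x. e2ennreal (f x) \<partial>M) < \<infinity>"
  shows "ereal_integral M (\<lambda>x. ereal a * f x) = ereal a * ereal_integral M f"
proof -
  have "(\<integral>\<^sup>+x. e2ennreal (ereal a * f x) \<partial>M) = ennreal a * (\<integral>\<^sup>+x. e2ennreal (f x) \<partial>M)"
    using assms by (simp add: e2ennreal_cmult nn_integral_cmult)
  moreover have "(\<integral>\<^sup>+x. e2ennreal (- (ereal a * f x)) \<partial>M) = ennreal a * (\<integral>\<^sup>+x. e2ennreal (- f x) \<partial>M)"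
    using assms by (simp add: e2ennreal_cmult nn_integral_cmult flip: ereal_mult_minus_right)
  ultimately show ?thesis
    using assms
    by (simp add: ereal_integral_def times_ennreal.rep_eq ereal_distrib_minus_left less_top)
qed

text \<open>
  Monotone convergence from above. The positive parts converge by domination by the first one, the
  negative parts increase; the limit of the integrals may be \<open>-\<infinity>\<close>.
\<close>

lemma ereal_integral_decreasing_limit:
  assumes [measurable]: "\<And>j. v j \<in> borel_measurable M" "u \<in> borel_measurable M"
    and dec: "\<And>x. x \<in> space M \<Longrightarrow> decseq (\<lambda>j. v j x)"
    and lim: "\<And>x. x \<in> space M \<Longrightarrow> (\<lambda>j. v j x) \<longlonglongrightarrow> u x"
    and int: "(\<integral>\<^sup>+x. e2ennreal (v 0 x) \<partial>M) < \<infinity>"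
  shows "(\<lambda>j. ereal_integral M (v j)) \<longlonglongrightarrow> ereal_integral M u"
proof -
  have le0: "v j x \<le> v 0 x" if "x \<in> space M" for j x
    using dec[OF that] by (simp add: decseq_def)
  have ule0: "u x \<le> v 0 x" if "x \<in> space M" for x
    using decseq_ge[OF dec lim] that by blast
  have pos: "(\<lambda>j. \<integral>\<^sup>+x. e2ennreal (v j x) \<partial>M) \<longlonglongrightarrow> (\<integral>\<^sup>+x. e2ennreal (u x) \<partial>M)"
    using int
    by (intro nn_integral_dominated_convergence[where w = "\<lambda>x. e2ennreal (v 0 x)"])
       (auto intro!: AE_I2 e2ennreal_mono le0 tendsto_e2ennrealI lim)
  have inc: "incseq (\<lambda>j. e2ennreal (- v j x))" if "x \<in> space M" for x
    using dec[OF that] by (auto simp: decseq_def incseq_def intro!: e2ennreal_mono)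
  have "(\<lambda>j. \<integral>\<^sup>+x. e2ennreal (- v j x) \<partial>M) \<longlonglongrightarrow> (SUP j. \<integral>\<^sup>+x. e2ennreal (- v j x) \<partial>M)"
    by (intro LIMSEQ_SUP incseq_SucI nn_integral_mono inc[THEN incseq_SucD])
  also have "(SUP j. \<integral>\<^sup>+x. e2ennreal (- v j x) \<partial>M) = (\<integral>\<^sup>+x. (SUP j. e2ennreal (- v j x)) \<partial>M)"
    by (intro nn_integral_monotone_convergence_SUP_AE[symmetric] AE_I2)
       (auto intro: inc[THEN incseq_SucD])
  also have "\<dots> = (\<integral>\<^sup>+x. e2ennreal (- u x) \<partial>M)"
  proof (intro nn_integral_cong)
    fix x assume x: "x \<in> space M"
    have "(\<lambda>j. e2ennreal (- v j x)) \<longlonglongrightarrow> e2ennreal (- u x)"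
      by (intro tendsto_intros lim x)
    then show "(SUP j. e2ennreal (- v j x)) = e2ennreal (- u x)"
      using LIMSEQ_SUP[OF inc[OF x]] LIMSEQ_unique by blast
  qed
  finally have neg: "(\<lambda>j. \<integral>\<^sup>+x. e2ennreal (- v j x) \<partial>M) \<longlonglongrightarrow> (\<integral>\<^sup>+x. e2ennreal (- u x) \<partial>M)" .
  have "(\<integral>\<^sup>+x. e2ennreal (u x) \<partial>M) \<le> (\<integral>\<^sup>+x. e2ennreal (v 0 x) \<partial>M)"
    by (intro nn_integral_mono e2ennreal_mono ule0)
  with int have "(\<integral>\<^sup>+x. e2ennreal (u x) \<partial>M) < \<infinity>"
    by (rule order.strict_trans1[rotated])
  then show ?thesis
    unfolding ereal_integral_def
    by (intro tendsto_diff_ereal_general tendsto_enn2erealI pos neg) (auto simp: less_top)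
qed

section \<open>Admissible functions and mean values over balls\<close>

text \<open>
  Since \<^const>\<open>e2ennreal\<close> cuts off negative values, integrating \<open>e2ennreal \<circ> u\<close> is integrating \<open>u\<^sup>+\<close>.
\<close>

lemma admissible_iff:
  "admissible D u \<longleftrightarrow> (\<forall>x\<in>D. u x < \<infinity>) \<and> u \<in> borel_measurable (lebesgue_on D) \<and>
     (\<forall>C. compact C \<and> C \<subseteq> D \<longrightarrow> (\<integral>\<^sup>+x. e2ennreal (u x) \<partial>lebesgue_on C) < \<infinity>)"
proof -
  have "e2ennreal \<bar>pos_part u x\<bar> = e2ennreal (u x)" for x
    by (metis abs_ereal_ge0 e2ennreal_pos_part max.cobounded2 pos_part_def)
  moreover have "pos_part u \<in> borel_measurable (lebesgue_on D)" if "u \<in> borel_measurable (lebesgue_on D)"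
    using that unfolding pos_part_def by measurable
  ultimately show ?thesis
    by (auto simp: admissible_def locally_integrable_def)
qed

lemma admissible_less_infty: "admissible D u \<Longrightarrow> x \<in> D \<Longrightarrow> u x < \<infinity>"
  by (simp add: admissible_def)

lemma admissible_measurable: "admissible D u \<Longrightarrow> S \<subseteq> D \<Longrightarrow> u \<in> borel_measurable (lebesgue_on S)"
  by (auto simp: admissible_def intro: measurable_restrict_mono)

lemma nn_integral_lebesgue_on_mono_set:
  assumes "S \<subseteq> T" "S \<in> sets lebesgue" "T \<in> sets lebesgue"
  shows "(\<integral>\<^sup>+x. f x \<partial>lebesgue_on S) \<le> (\<integral>\<^sup>+x. f x \<partial>lebesgue_on T)"
  using assms by (auto simp: nn_integral_restrict_space intro!: nn_integral_mono split: split_indicator)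

lemma admissible_integral_ball:
  fixes u :: "'a::euclidean_space \<Rightarrow> ereal"
  assumes "admissible D u" "cball x r \<subseteq> D"
  shows "(\<integral>\<^sup>+x. e2ennreal (u x) \<partial>lebesgue_on (ball x r)) < \<infinity>"
proof -
  have "(\<integral>\<^sup>+x. e2ennreal (u x) \<partial>lebesgue_on (ball x r)) \<le> (\<integral>\<^sup>+x. e2ennreal (u x) \<partial>lebesgue_on (cball x r))"
    by (intro nn_integral_lebesgue_on_mono_set) auto
  also have "\<dots> < \<infinity>"
    using assms by (simp add: admissible_iff)
  finally show ?thesis .
qed

lemma measure_lebesgue_ball:
  fixes x :: "'a::euclidean_space"
  assumes "0 \<le> r"
  shows "measure lebesgue (ball x r) = measure lebesgue (ball (0::'a) 1) * r ^ DIM('a)"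
  using content_ball[OF assms, of x] content_ball[of 1 "0::'a"] by simp

lemma measure_lebesgue_unit_ball_pos: "0 < measure lebesgue (ball (0::'a::euclidean_space) 1)"
  using content_ball[of 1 "0::'a"] by simp

lemma qns_mean_mono:
  assumes "0 \<le> K" "0 \<le> r" "\<And>y. y \<in> ball x r \<Longrightarrow> u y \<le> v y"
  shows "qns_mean K u x r \<le> qns_mean K v x r"
  unfolding qns_mean_def
  by (intro ereal_mult_left_mono ereal_integral_mono) (use assms in auto)

lemma qns_mean_nonneg:
  assumes "0 \<le> K" "0 \<le> r" "\<And>y. y \<in> ball x r \<Longrightarrow> 0 \<le> u y"
  shows "0 \<le> qns_mean K u x r"
  unfolding qns_mean_def by (subst ereal_integral_nonneg) (use assms in auto)

lemma qns_mean_mono_const: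
  assumes "0 \<le> r" "K \<le> L" "\<And>y. y \<in> ball x r \<Longrightarrow> 0 \<le> u y"
  shows "qns_mean K u x r \<le> qns_mean L u x r"
proof -
  have "0 \<le> ereal_integral (lebesgue_on (ball x r)) u"
    using assms(3) by (subst ereal_integral_nonneg) auto
  then show ?thesis
    unfolding qns_mean_def using assms
    by (intro ereal_mult_right_mono) (auto intro!: divide_right_mono)
qed

lemma qns_mean_less_infty:
  assumes "0 \<le> K" "0 \<le> r" "(\<integral>\<^sup>+y. e2ennreal (u y) \<partial>lebesgue_on (ball x r)) < \<infinity>"
  shows "qns_mean K u x r < \<infinity>"
proof -
  let ?c = "K / (measure lebesgue (ball (0::'a) 1) * r ^ DIM('a))"
  have "qns_mean K u x r \<le> ereal ?c * enn2ereal (\<integral>\<^sup>+y. e2ennreal (u y) \<partial>lebesgue_on (ball x r))"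
    unfolding qns_mean_def by (intro ereal_mult_left_mono ereal_integral_le_pos) (use assms in auto)
  also have "\<dots> < \<infinity>"
    using assms(3) by (cases "\<integral>\<^sup>+y. e2ennreal (u y) \<partial>lebesgue_on (ball x r)") auto
  finally show ?thesis .
qed

section \<open>Truncations\<close>

lemma ereal_cmult_less_infty: "0 \<le> a \<Longrightarrow> x < \<infinity> \<Longrightarrow> ereal a * x < \<infinity>"
  by (cases x) auto

lemma pos_part_mono: "u x \<le> v x \<Longrightarrow> pos_part u x \<le> pos_part v x"
  unfolding pos_part_def by (intro max.mono) auto

lemma trunc_nonneg: "0 \<le> trunc M u x"
  unfolding trunc_def by (cases "u x") (auto simp: max_def)

lemma trunc_mono: "u x \<le> v x \<Longrightarrow> trunc M u x \<le> trunc M v x"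
  unfolding trunc_def by (intro add_right_mono max.mono) auto

lemma trunc_zero: "trunc 0 u = pos_part u"
  by (simp add: trunc_def pos_part_def zero_ereal_def[symmetric])

text \<open>
  Since the right side of the submean inequality for a truncation is nonnegative, that inequality is
  an upper bound on \<open>u x\<close> alone; in this form it passes to suprema.
\<close>

lemma trunc_le_iff: "0 \<le> R \<Longrightarrow> trunc M u x \<le> R \<longleftrightarrow> u x \<le> R - ereal M"
  unfolding trunc_def by (cases "u x"; cases R) (auto simp: max_def)

lemma trunc_max: "trunc M (\<lambda>x. max (u x) (v x)) x = max (trunc M u x) (trunc M v x)"
proof -
  have "mono (\<lambda>t. max t (- ereal M) + ereal M)"
    by (intro monoI add_right_mono max.mono) auto
  then show ?thesis
    unfolding trunc_def by (rule max_of_mono[symmetric])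
qed

lemma measurable_trunc [measurable]: "u \<in> borel_measurable A \<Longrightarrow> trunc M u \<in> borel_measurable A"
  unfolding trunc_def by (intro borel_measurable_ereal_add borel_measurable_max borel_measurable_const)

lemma integral_trunc_ball_less_infty:
  fixes u :: "'a::euclidean_space \<Rightarrow> ereal"
  assumes "admissible D u" "cball x r \<subseteq> D" "0 \<le> M"
  shows "(\<integral>\<^sup>+x. e2ennreal (trunc M u x) \<partial>lebesgue_on (ball x r)) < \<infinity>"
proof -
  have [measurable]: "u \<in> borel_measurable (lebesgue_on (ball x r))"
    using assms ball_subset_cball by (blast intro: admissible_measurable)
  have "e2ennreal (trunc M u y) \<le> e2ennreal (u y) + ennreal M" for y
  proof -
    have "trunc M u y \<le> max (u y) 0 + ereal M"
      unfolding trunc_def by (intro add_right_mono max.mono) (use assms in auto)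
    then have "e2ennreal (trunc M u y) \<le> e2ennreal (max (u y) 0 + ereal M)"
      by (rule e2ennreal_mono)
    also have "\<dots> \<le> e2ennreal (max (u y) 0) + e2ennreal (ereal M)"
      by (rule e2ennreal_add_le)
    finally show ?thesis
      by simp
  qed
  then have "(\<integral>\<^sup>+x. e2ennreal (trunc M u x) \<partial>lebesgue_on (ball x r))
      \<le> (\<integral>\<^sup>+x. e2ennreal (u x) + ennreal M \<partial>lebesgue_on (ball x r))"
    by (intro nn_integral_mono)
  also have "\<dots> = (\<integral>\<^sup>+x. e2ennreal (u x) \<partial>lebesgue_on (ball x r)) + ennreal M * emeasure lebesgue (ball x r)"
    by (simp add: nn_integral_add emeasure_restrict_space)
  also have "\<dots> < \<infinity>"
    using admissible_integral_ball[OF assms(1,2)] emeasure_lborel_ball_finite[of x r]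
    by (simp add: ennreal_mult_less_top)
  finally show ?thesis .
qed

section \<open>Larger constants, linear combinations and local upper bounds\<close>

lemma K_qns_constant_mono:
  assumes "K_qns K D u" "K \<le> L"
  shows "K_qns L D u"
  unfolding K_qns_def
proof (intro conjI allI impI; (elim conjE)?)
  show "admissible D u"
    using assms by (simp add: K_qns_def)
  fix M x r assume "0 \<le> (M::real)" and r: "0 < r" "cball x r \<subseteq> D"
  then have "trunc M u x \<le> qns_mean K (trunc M u) x r"
    using assms by (simp add: K_qns_def)
  also have "\<dots> \<le> qns_mean L (trunc M u) x r"
    using assms r by (intro qns_mean_mono_const trunc_nonneg) auto
  finally show "trunc M u x \<le> qns_mean L (trunc M u) x r" .
qed

lemma admissible_linear_combination:
  assumes u: "admissible D u" and v: "admissible D v" and ab: "0 \<le> a" "0 \<le> b"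
  shows "admissible D (\<lambda>x. ereal a * u x + ereal b * v x)"
  unfolding admissible_iff
proof (intro conjI ballI allI impI; (elim conjE)?)
  fix x assume "x \<in> D"
  with u v have "u x < \<infinity>" "v x < \<infinity>"
    by (simp_all add: admissible_def)
  with ab show "ereal a * u x + ereal b * v x < \<infinity>"
    by (cases "u x"; cases "v x") auto
next
  show "(\<lambda>x. ereal a * u x + ereal b * v x) \<in> borel_measurable (lebesgue_on D)"
    using admissible_measurable[OF u order_refl] admissible_measurable[OF v order_refl] by measurable
next
  fix C assume C: "compact C" "C \<subseteq> D"
  have [measurable]: "u \<in> borel_measurable (lebesgue_on C)" "v \<in> borel_measurable (lebesgue_on C)"
    using u v C by (auto intro: admissible_measurable)
  have "(\<integral>\<^sup>+x. e2ennreal (ereal a * u x + ereal b * v x) \<partial>lebesgue_on C)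
     \<le> (\<integral>\<^sup>+x. e2ennreal (ereal a * u x) + e2ennreal (ereal b * v x) \<partial>lebesgue_on C)"
    by (intro nn_integral_mono e2ennreal_add_le)
  also have "\<dots> = ennreal a * (\<integral>\<^sup>+x. e2ennreal (u x) \<partial>lebesgue_on C) + ennreal b * (\<integral>\<^sup>+x. e2ennreal (v x) \<partial>lebesgue_on C)"
    using ab by (simp add: nn_integral_add nn_integral_cmult e2ennreal_cmult)
  also have "\<dots> < \<infinity>"
    using u v C by (auto simp: admissible_iff ennreal_mult_less_top)
  finally show "(\<integral>\<^sup>+x. e2ennreal (ereal a * u x + ereal b * v x) \<partial>lebesgue_on C) < \<infinity>" .
qed

lemma K_qns_ns_linear_combination:
  fixes u v :: "'a::euclidean_space \<Rightarrow> ereal"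
  assumes u: "K_qns_ns K D u" and v: "K_qns_ns K D v" and ab: "0 \<le> a" "0 \<le> b" and K: "0 \<le> K"
  shows "K_qns_ns K D (\<lambda>x. ereal a * u x + ereal b * v x)"
  unfolding K_qns_ns_def
proof (intro conjI allI impI; (elim conjE)?)
  have adm: "admissible D u" "admissible D v"
    using u v by (simp_all add: K_qns_ns_def)
  then show "admissible D (\<lambda>x. ereal a * u x + ereal b * v x)"
    using ab by (rule admissible_linear_combination)
  fix x r assume r: "0 < r" "cball x r \<subseteq> D"
  let ?B = "lebesgue_on (ball x r)"
  let ?I = "ereal_integral ?B"
  let ?c = "K / (measure lebesgue (ball (0::'a) 1) * r ^ DIM('a))"
  have sub: "ball x r \<subseteq> D"
    using r ball_subset_cball by blast
  have [measurable]: "u \<in> borel_measurable ?B" "v \<in> borel_measurable ?B"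
    using adm sub by (auto intro: admissible_measurable)
  have fin: "(\<integral>\<^sup>+x. e2ennreal (u x) \<partial>?B) < \<infinity>" "(\<integral>\<^sup>+x. e2ennreal (v x) \<partial>?B) < \<infinity>"
    using adm r admissible_integral_ball by blast+
  have lt: "u y < \<infinity>" "v y < \<infinity>" if "y \<in> ball x r" for y
    using adm sub that by (auto simp: admissible_def)
  have "?I (\<lambda>x. ereal a * u x + ereal b * v x) = ?I (\<lambda>x. ereal a * u x) + ?I (\<lambda>x. ereal b * v x)"
  proof (rule ereal_integral_add)
    show "(\<integral>\<^sup>+x. e2ennreal (ereal a * u x) \<partial>?B) < \<infinity>" "(\<integral>\<^sup>+x. e2ennreal (ereal b * v x) \<partial>?B) < \<infinity>"
      using ab fin by (simp_all add: e2ennreal_cmult nn_integral_cmult ennreal_mult_less_top)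
    show "ereal a * u y < \<infinity>" "ereal b * v y < \<infinity>" if "y \<in> space ?B" for y
      using lt[of y] that ab by (auto intro!: ereal_cmult_less_infty simp del: ereal_infty_less)
  qed measurable
  also have "\<dots> = ereal a * ?I u + ereal b * ?I v"
    using ab fin by (simp add: ereal_integral_cmult)
  finally have I: "?I (\<lambda>x. ereal a * u x + ereal b * v x) = ereal a * ?I u + ereal b * ?I v" .
  have Ilt: "?I u < \<infinity>" "?I v < \<infinity>"
    using fin ereal_integral_le_pos[of ?B u] ereal_integral_le_pos[of ?B v]
    by (auto simp: less_top[symmetric] top_ereal_def)
  have "ereal a * u x + ereal b * v x \<le> ereal a * (ereal ?c * ?I u) + ereal b * (ereal ?c * ?I v)"
    using u v r ab by (intro add_mono ereal_mult_left_mono) (auto simp: K_qns_ns_def qns_mean_def)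
  also have "\<dots> = ereal ?c * (ereal a * ?I u + ereal b * ?I v)"
  proof -
    have "ereal a * ?I u \<noteq> \<infinity>" "ereal b * ?I v \<noteq> \<infinity>"
      using ereal_cmult_less_infty[OF ab(1) Ilt(1)] ereal_cmult_less_infty[OF ab(2) Ilt(2)] by simp_all
    then show ?thesis
      by (subst ereal_distrib_left) (simp_all add: ac_simps)
  qed
  finally show "ereal a * u x + ereal b * v x \<le> qns_mean K (\<lambda>x. ereal a * u x + ereal b * v x) x r"
    by (simp add: qns_mean_def I)
qed

lemma K_qns_locally_bounded_above:
  fixes u :: "'a::euclidean_space \<Rightarrow> ereal"
  assumes u: "K_qns K D u" and K: "0 \<le> K" and "open D"
  shows "locally_bounded_above D u"
  unfolding locally_bounded_above_def
proof
  fix x assume "x \<in> D"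
  then obtain e where e: "0 < e" "cball x e \<subseteq> D"
    using \<open>open D\<close> open_contains_cball by blast
  define r where "r = e / 2"
  have r: "0 < r" "cball x (2 * r) \<subseteq> D"
    using e by (auto simp: r_def)
  define I where "I = (\<integral>\<^sup>+y. e2ennreal (u y) \<partial>lebesgue_on (cball x (2 * r)))"
  let ?c = "K / (measure lebesgue (ball (0::'a) 1) * r ^ DIM('a))"
  have adm: "admissible D u"
    using u by (simp add: K_qns_def)
  then have "I < \<infinity>"
    using r by (auto simp: I_def admissible_iff)
  then have I: "enn2ereal I = ereal (enn2real I)"
    by (cases I) auto
  have "u y \<le> ereal (?c * enn2real I)" if "y \<in> ball x r" for y
  proof -
    have sub: "cball y r \<subseteq> cball x (2 * r)"
      using that by (subst cball_subset_cball_iff) (simp add: dist_commute)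
    \<comment> \<open>All balls \<open>ball y r\<close> with centre in \<open>ball x r\<close> lie in one compact ball, so that the mean values of \<open>u\<^sup>+\<close> over them have a common bound.\<close>
    have "u y \<le> trunc 0 u y"
      by (simp add: trunc_zero pos_part_def)
    also have "\<dots> \<le> qns_mean K (trunc 0 u) y r"
      using u r sub by (auto simp: K_qns_def)
    also have "\<dots> = ereal ?c * enn2ereal (\<integral>\<^sup>+y. e2ennreal (u y) \<partial>lebesgue_on (ball y r))"
      unfolding qns_mean_def
      by (subst ereal_integral_nonneg) (simp_all add: trunc_zero pos_part_def)
    also have "\<dots> \<le> ereal ?c * enn2ereal I"
    proof (intro ereal_mult_left_mono)
      have "(\<integral>\<^sup>+y. e2ennreal (u y) \<partial>lebesgue_on (ball y r)) \<le> I"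
        unfolding I_def
      proof (rule nn_integral_lebesgue_on_mono_set)
        show "ball y r \<subseteq> cball x (2 * r)"
          using sub ball_subset_cball by blast
      qed auto
      then show "enn2ereal (\<integral>\<^sup>+y. e2ennreal (u y) \<partial>lebesgue_on (ball y r)) \<le> enn2ereal I"
        by (simp add: less_eq_ennreal.rep_eq)
    qed (use K r in auto)
    finally show ?thesis
      by (simp add: I)
  qed
  with \<open>0 < r\<close> show "\<exists>e>0. \<exists>C::real. \<forall>y\<in>ball x e \<inter> D. u y \<le> ereal C"
    by blast
qed

section \<open>Decreasing limits\<close>

text \<open>
  The submean inequality survives decreasing limits; it is applied to \<open>u\<close> itself and to its truncations.
\<close>

lemma submean_decreasing_limit:
  fixes u :: "'a::euclidean_space \<Rightarrow> ereal"
  assumes "0 < r" and "\<And>j. v j \<in> borel_measurable (lebesgue_on (ball x r))"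
    and "u \<in> borel_measurable (lebesgue_on (ball x r))"
    and "\<And>y. y \<in> ball x r \<Longrightarrow> decseq (\<lambda>j. v j y)"
    and lim: "\<And>y. y \<in> ball x r \<Longrightarrow> (\<lambda>j. v j y) \<longlonglongrightarrow> u y"
    and "(\<integral>\<^sup>+x. e2ennreal (v 0 x) \<partial>lebesgue_on (ball x r)) < \<infinity>"
    and le: "\<And>j. v j x \<le> qns_mean K (v j) x r"
  shows "u x \<le> qns_mean K u x r"
proof (rule LIMSEQ_le)
  show "(\<lambda>j. v j x) \<longlonglongrightarrow> u x"
    using \<open>0 < r\<close> by (intro lim) auto
  show "(\<lambda>j. qns_mean K (v j) x r) \<longlonglongrightarrow> qns_mean K u x r"
    unfolding qns_mean_def
    by (intro tendsto_cmult_ereal ereal_integral_decreasing_limit) (use assms in auto)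
qed (use le in auto)

lemma admissible_mono:
  assumes "admissible D v" "u \<in> borel_measurable (lebesgue_on D)" "\<And>x. x \<in> D \<Longrightarrow> u x \<le> v x"
  shows "admissible D u"
  unfolding admissible_iff
proof (intro conjI ballI allI impI)
  show "u x < \<infinity>" if "x \<in> D" for x
    using assms that by (meson admissible_def order.strict_trans1)
  fix C assume C: "compact C \<and> C \<subseteq> D"
  then have "(\<integral>\<^sup>+x. e2ennreal (u x) \<partial>lebesgue_on C) \<le> (\<integral>\<^sup>+x. e2ennreal (v x) \<partial>lebesgue_on C)"
    by (intro nn_integral_mono e2ennreal_mono assms) auto
  also have "\<dots> < \<infinity>"
    using assms(1) C by (simp add: admissible_iff)
  finally show "(\<integral>\<^sup>+x. e2ennreal (u x) \<partial>lebesgue_on C) < \<infinity>" .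
qed (fact assms)

lemma admissible_decreasing_limit:
  assumes "\<And>j. admissible D (v j)" "\<And>x. x \<in> D \<Longrightarrow> decseq (\<lambda>j. v j x)" "\<And>x. x \<in> D \<Longrightarrow> (\<lambda>j. v j x) \<longlonglongrightarrow> u x"
  shows "admissible D u"
proof (rule admissible_mono)
  show "u \<in> borel_measurable (lebesgue_on D)"
  proof (rule borel_measurable_LIMSEQ_order)
    show "(\<lambda>j. v j x) \<longlonglongrightarrow> u x" if "x \<in> space (lebesgue_on D)" for x
      using that by (intro assms) auto
    show "v j \<in> borel_measurable (lebesgue_on D)" for j
      using assms(1) by (simp add: admissible_def)
  qed
  show "u x \<le> v 0 x" if "x \<in> D" for x
    using decseq_ge[OF assms(2,3)] that by blast
qed (fact assms)

lemma K_qns_ns_decreasing_limit: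
  assumes v: "\<And>j. K_qns_ns K D (v j)"
    and dec: "\<And>x. x \<in> D \<Longrightarrow> decseq (\<lambda>j. v j x)" and lim: "\<And>x. x \<in> D \<Longrightarrow> (\<lambda>j. v j x) \<longlonglongrightarrow> u x"
  shows "K_qns_ns K D u"
  unfolding K_qns_ns_def
proof (intro conjI allI impI; (elim conjE)?)
  have adm: "admissible D (v j)" for j
    using v by (simp add: K_qns_ns_def)
  then show admu: "admissible D u"
    using dec lim by (rule admissible_decreasing_limit)
  fix x r assume r: "0 < r" "cball x r \<subseteq> D"
  then have sub: "ball x r \<subseteq> D"
    using ball_subset_cball by blast
  show "u x \<le> qns_mean K u x r"
  proof (rule submean_decreasing_limit[where v = v])
    show "v j x \<le> qns_mean K (v j) x r" for j
      using v r by (simp add: K_qns_ns_def)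
    show "(\<integral>\<^sup>+x. e2ennreal (v 0 x) \<partial>lebesgue_on (ball x r)) < \<infinity>"
      using adm r(2) by (rule admissible_integral_ball)
  qed (use sub r in \<open>auto intro: dec lim admissible_measurable[OF adm] admissible_measurable[OF admu]\<close>)
qed

lemma K_qns_decreasing_limit:
  assumes v: "\<And>j. K_qns K D (v j)"
    and dec: "\<And>x. x \<in> D \<Longrightarrow> decseq (\<lambda>j. v j x)" and lim: "\<And>x. x \<in> D \<Longrightarrow> (\<lambda>j. v j x) \<longlonglongrightarrow> u x"
  shows "K_qns K D u"
  unfolding K_qns_def
proof (intro conjI allI impI; (elim conjE)?)
  have adm: "admissible D (v j)" for j
    using v by (simp add: K_qns_def)
  then show admu: "admissible D u"
    using dec lim by (rule admissible_decreasing_limit)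
  fix M x r assume M: "0 \<le> (M::real)" and r: "0 < r" "cball x r \<subseteq> D"
  then have sub: "ball x r \<subseteq> D"
    using ball_subset_cball by blast
  show "trunc M u x \<le> qns_mean K (trunc M u) x r"
  proof (rule submean_decreasing_limit[where v = "\<lambda>j. trunc M (v j)"])
    show "trunc M (v j) x \<le> qns_mean K (trunc M (v j)) x r" for j
      using v r M by (simp add: K_qns_def)
    show "decseq (\<lambda>j. trunc M (v j) y)" if "y \<in> ball x r" for y
      using dec[of y] sub that by (auto simp: decseq_def intro!: trunc_mono)
    show "(\<lambda>j. trunc M (v j) y) \<longlonglongrightarrow> trunc M u y" if "y \<in> ball x r" for y
      unfolding trunc_def using sub that
      by (intro tendsto_add_ereal_nonneg tendsto_max tendsto_const lim) (auto simp: max_def)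
    show "(\<integral>\<^sup>+x. e2ennreal (trunc M (v 0) x) \<partial>lebesgue_on (ball x r)) < \<infinity>"
      using adm r(2) M by (rule integral_trunc_ball_less_infty)
  qed (use sub r in \<open>auto intro!: measurable_trunc admissible_measurable[OF adm] admissible_measurable[OF admu]\<close>)
qed

section \<open>Maxima\<close>

lemma admissible_max:
  assumes u: "admissible D u" and v: "admissible D v"
  shows "admissible D (\<lambda>x. max (u x) (v x))"
  unfolding admissible_iff
proof (intro conjI ballI allI impI; (elim conjE)?)
  show "max (u x) (v x) < \<infinity>" if "x \<in> D" for x
    using u v that by (simp add: admissible_def max_def)
  show "(\<lambda>x. max (u x) (v x)) \<in> borel_measurable (lebesgue_on D)"
    using admissible_measurable[OF u order_refl] admissible_measurable[OF v order_refl]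
    by (intro borel_measurable_max)
  fix C assume C: "compact C" "C \<subseteq> D"
  have [measurable]: "u \<in> borel_measurable (lebesgue_on C)" "v \<in> borel_measurable (lebesgue_on C)"
    using u v C by (auto intro: admissible_measurable)
  have "(\<integral>\<^sup>+x. e2ennreal (max (u x) (v x)) \<partial>lebesgue_on C)
     \<le> (\<integral>\<^sup>+x. e2ennreal (u x) + e2ennreal (v x) \<partial>lebesgue_on C)"
    by (intro nn_integral_mono) (simp add: max_def)
  also have "\<dots> = (\<integral>\<^sup>+x. e2ennreal (u x) \<partial>lebesgue_on C) + (\<integral>\<^sup>+x. e2ennreal (v x) \<partial>lebesgue_on C)"
    by (simp add: nn_integral_add)
  also have "\<dots> < \<infinity>"
    using u v C by (auto simp: admissible_iff)
  finally show "(\<integral>\<^sup>+x. e2ennreal (max (u x) (v x)) \<partial>lebesgue_on C) < \<infinity>" .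
qed

lemma K_qns_max:
  assumes u: "K_qns K D u" and v: "K_qns L D v" and KL: "0 \<le> K" "0 \<le> L"
  shows "K_qns (max K L) D (\<lambda>x. max (u x) (v x))"
  unfolding K_qns_def
proof (intro conjI allI impI; (elim conjE)?)
  let ?w = "\<lambda>x. max (u x) (v x)"
  show "admissible D ?w"
    using u v by (auto simp: K_qns_def intro: admissible_max)
  fix M x r assume M: "0 \<le> (M::real)" and r: "0 < r" "cball x r \<subseteq> D"
  have *: "trunc M f x \<le> qns_mean (max K L) (trunc M ?w) x r"
    if f: "K_qns (max K L) D f" and le: "\<And>y. f y \<le> ?w y" for f
  proof -
    have "trunc M f x \<le> qns_mean (max K L) (trunc M f) x r"
      using f M r by (simp add: K_qns_def)
    also have "\<dots> \<le> qns_mean (max K L) (trunc M ?w) x r"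
      using KL r by (intro qns_mean_mono trunc_mono le) auto
    finally show ?thesis .
  qed
  show "trunc M ?w x \<le> qns_mean (max K L) (trunc M ?w) x r"
    unfolding trunc_max[of M u v x]
    using K_qns_constant_mono[OF u, of "max K L"] K_qns_constant_mono[OF v, of "max K L"]
    by (intro max.boundedI *) auto
qed

text \<open>
  Equality holds here: the truncation is the constant \<open>M\<close>, whose mean value is \<open>M\<close>.
\<close>

lemma K_qns_zero: "K_qns 1 D (\<lambda>_::'a::euclidean_space. 0)"
  unfolding K_qns_def
proof (intro conjI allI impI; (elim conjE)?)
  show "admissible D (\<lambda>_::'a. 0)"
    by (simp add: admissible_iff e2ennreal_neg)
  fix M r :: real and x :: 'a assume M: "0 \<le> M" and r: "0 < r"
  have tr: "trunc M (\<lambda>_::'a. 0) y = ereal M" for y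
    using M by (simp add: trunc_def max_def)
  define b where "b = measure lebesgue (ball (0::'a) 1)"
  have b: "0 < b"
    unfolding b_def by (rule measure_lebesgue_unit_ball_pos)
  have "emeasure lebesgue (ball x r) = ennreal (measure lebesgue (ball x r))"
    using emeasure_lborel_ball_finite[of x r] by (intro emeasure_eq_ennreal_measure) auto
  also have "measure lebesgue (ball x r) = b * r ^ DIM('a)"
    unfolding b_def using r by (intro measure_lebesgue_ball) simp
  finally have "ereal_integral (lebesgue_on (ball x r)) (trunc M (\<lambda>_. 0)) = ereal (M * (b * r ^ DIM('a)))"
    by (subst ereal_integral_nonneg)
       (use M b r in \<open>simp_all add: tr emeasure_restrict_space flip: ennreal_mult\<close>)
  then show "trunc M (\<lambda>_. 0) x \<le> qns_mean 1 (trunc M (\<lambda>_. 0)) x r"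
    using r b by (simp add: tr qns_mean_def flip: b_def)
qed

lemma K_qns_pos_part:
  assumes "K_qns K D u" "1 \<le> K"
  shows "K_qns K D (pos_part u)"
  using K_qns_max[OF assms(1) K_qns_zero] assms(2) by (simp add: pos_part_def max_def)

section \<open>Suprema of families\<close>

text \<open>
  That \<open>w < \<infinity>\<close> everywhere is not assumed: at each point the submean inequality bounds all members of
  the family by the same finite mean value of \<open>w\<^sup>+\<close>. The family may be empty (then \<open>w = -\<infinity>\<close>) or
  uncountable.
\<close>

lemma admissible_SUP:
  fixes w :: "'a::euclidean_space \<Rightarrow> ereal"
  assumes w: "w = (\<lambda>x. SUP u\<in>F. u x)" and meas: "w \<in> borel_measurable (lebesgue_on D)"
    and loc: "locally_integrable D (pos_part w)" and "open D" and K: "0 \<le> K"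
    and F: "\<And>u x r. u \<in> F \<Longrightarrow> 0 < r \<Longrightarrow> cball x r \<subseteq> D \<Longrightarrow> u x \<le> qns_mean K (pos_part u) x r"
  shows "admissible D w"
  unfolding admissible_def
proof (intro conjI ballI meas loc)
  fix x assume "x \<in> D"
  then obtain r where r: "0 < r" "cball x r \<subseteq> D"
    using \<open>open D\<close> open_contains_cball by blast
  have "w x \<le> qns_mean K (pos_part w) x r"
    unfolding w
  proof (rule SUP_least)
    fix u assume u: "u \<in> F"
    have "u x \<le> qns_mean K (pos_part u) x r"
      using u r by (rule F)
    also have "\<dots> \<le> qns_mean K (pos_part (\<lambda>x. SUP u\<in>F. u x)) x r"
      using K r u by (intro qns_mean_mono pos_part_mono) (auto intro: SUP_upper)
    finally show "u x \<le> \<dots>" .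
  qed
  also have "\<dots> < \<infinity>"
  proof (rule qns_mean_less_infty)
    have "(\<integral>\<^sup>+y. e2ennreal (pos_part w y) \<partial>lebesgue_on (ball x r))
        \<le> (\<integral>\<^sup>+y. e2ennreal (pos_part w y) \<partial>lebesgue_on (cball x r))"
      by (intro nn_integral_lebesgue_on_mono_set) auto
    also have "\<dots> = (\<integral>\<^sup>+y. e2ennreal \<bar>pos_part w y\<bar> \<partial>lebesgue_on (cball x r))"
      by (simp add: pos_part_def)
    also have "\<dots> < \<infinity>"
      using loc r by (simp add: locally_integrable_def)
    finally show "(\<integral>\<^sup>+y. e2ennreal (pos_part w y) \<partial>lebesgue_on (ball x r)) < \<infinity>" .
  qed (use K r in auto)
  finally show "w x < \<infinity>" .
qed

lemma K_qns_SUP: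
  fixes w :: "'a::euclidean_space \<Rightarrow> ereal"
  assumes w: "w = (\<lambda>x. SUP u\<in>F. u x)" and meas: "w \<in> borel_measurable (lebesgue_on D)"
    and loc: "locally_integrable D (pos_part w)" and "open D" and K: "0 \<le> K"
    and F: "\<And>u. u \<in> F \<Longrightarrow> K_qns K D u"
  shows "K_qns K D w"
  unfolding K_qns_def
proof (intro conjI allI impI; (elim conjE)?)
  show "admissible D w"
  proof (rule admissible_SUP[OF w meas loc \<open>open D\<close> K])
    fix u x r assume "u \<in> F" and r: "0 < (r::real)" "cball x r \<subseteq> D"
    have "u x \<le> trunc 0 u x"
      by (simp add: trunc_zero pos_part_def)
    also have "\<dots> \<le> qns_mean K (trunc 0 u) x r"
      using F[OF \<open>u \<in> F\<close>] r by (simp add: K_qns_def)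
    finally show "u x \<le> qns_mean K (pos_part u) x r"
      by (simp add: trunc_zero)
  qed
  fix M x r assume M: "0 \<le> (M::real)" and r: "0 < (r::real)" "cball x r \<subseteq> D"
  let ?R = "qns_mean K (trunc M w) x r"
  have R: "0 \<le> ?R"
    using K r by (intro qns_mean_nonneg trunc_nonneg) auto
  have "w x \<le> ?R - ereal M"
    unfolding fun_cong[OF w, of x]
  proof (rule SUP_least)
    fix u assume u: "u \<in> F"
    have "trunc M u x \<le> qns_mean K (trunc M u) x r"
      using F[OF u] M r by (simp add: K_qns_def)
    also have "\<dots> \<le> ?R"
      using K r u by (intro qns_mean_mono trunc_mono) (auto simp: w intro: SUP_upper)
    finally show "u x \<le> ?R - ereal M"
      unfolding trunc_le_iff[OF R] .
  qed
  then show "trunc M w x \<le> ?R"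
    unfolding trunc_le_iff[OF R] .
qed

lemma K_qns_ns_SUP:
  fixes w :: "'a::euclidean_space \<Rightarrow> ereal"
  assumes w: "w = (\<lambda>x. SUP u\<in>F. u x)" and meas: "w \<in> borel_measurable (lebesgue_on D)"
    and loc: "locally_integrable D (pos_part w)" and "open D" and K: "0 \<le> K"
    and F: "\<And>u. u \<in> F \<Longrightarrow> K_qns_ns K D u"
  shows "K_qns_ns K D w"
  unfolding K_qns_ns_def
proof (intro conjI allI impI; (elim conjE)?)
  show "admissible D w"
  proof (rule admissible_SUP[OF w meas loc \<open>open D\<close> K])
    fix u x r assume "u \<in> F" and r: "0 < (r::real)" "cball x r \<subseteq> D"
    then have "u x \<le> qns_mean K u x r"
      using F by (simp add: K_qns_ns_def)
    also have "\<dots> \<le> qns_mean K (pos_part u) x r"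
      using K r by (intro qns_mean_mono) (auto simp: pos_part_def)
    finally show "u x \<le> qns_mean K (pos_part u) x r" .
  qed
  fix x r assume r: "0 < (r::real)" "cball x r \<subseteq> D"
  show "w x \<le> qns_mean K w x r"
    unfolding fun_cong[OF w, of x]
  proof (rule SUP_least)
    fix u assume u: "u \<in> F"
    have "u x \<le> qns_mean K u x r"
      using F[OF u] r by (simp add: K_qns_ns_def)
    also have "\<dots> \<le> qns_mean K w x r"
      using K r u by (intro qns_mean_mono) (auto simp: w intro: SUP_upper)
    finally show "u x \<le> qns_mean K w x r" .
  qed
qed

section \<open>The alternative between minus infinity and local integrability\<close>

text \<open>
  The submean inequality forces a finite integral around every point where \<open>u > -\<infinity>\<close>.
\<close>

lemma K_qns_ns_integrable_ball:
  fixes u :: "'a::euclidean_space \<Rightarrow> ereal"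
  assumes u: "K_qns_ns K D u" and K: "0 < K" and r: "0 < r" "cball y r \<subseteq> D" and y: "u y \<noteq> -\<infinity>"
  shows "(\<integral>\<^sup>+x. e2ennreal \<bar>u x\<bar> \<partial>lebesgue_on (ball y r)) < \<infinity>"
proof -
  let ?B = "lebesgue_on (ball y r)"
  define c where "c = K / (measure lebesgue (ball (0::'a) 1) * r ^ DIM('a))"
  let ?P = "\<integral>\<^sup>+x. e2ennreal (u x) \<partial>?B" and ?N = "\<integral>\<^sup>+x. e2ennreal (- u x) \<partial>?B"
  have adm: "admissible D u"
    using u by (simp add: K_qns_ns_def)
  have [measurable]: "u \<in> borel_measurable ?B"
    using adm r ball_subset_cball by (blast intro: admissible_measurable)
  have P: "?P < \<infinity>"
    using adm r(2) by (rule admissible_integral_ball)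
  have c: "0 < c"
    unfolding c_def using K r measure_lebesgue_unit_ball_pos
    by (intro divide_pos_pos mult_pos_pos zero_less_power)
  have "u y \<le> ereal c * (enn2ereal ?P - enn2ereal ?N)"
    using u r unfolding c_def by (simp add: K_qns_ns_def qns_mean_def ereal_integral_def)
  with y P c have N: "?N < \<infinity>"
    by (cases ?P; cases ?N) auto
  have "e2ennreal \<bar>t\<bar> \<le> e2ennreal t + e2ennreal (- t)" for t
    by (cases "0 \<le> t") (auto simp: not_le)
  then have "(\<integral>\<^sup>+x. e2ennreal \<bar>u x\<bar> \<partial>?B) \<le> (\<integral>\<^sup>+x. e2ennreal (u x) + e2ennreal (- u x) \<partial>?B)"
    by (intro nn_integral_mono)
  also have "\<dots> = ?P + ?N"
    by (simp add: nn_integral_add)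
  also have "\<dots> < \<infinity>"
    using P N by simp
  finally show ?thesis .
qed

lemma nn_integral_compact_less_infty:
  fixes f :: "'a::euclidean_space \<Rightarrow> ennreal"
  assumes f: "f \<in> borel_measurable (lebesgue_on D)" and C: "compact C"
    and loc: "\<And>x. x \<in> C \<Longrightarrow> \<exists>e>0. ball x e \<subseteq> D \<and> (\<integral>\<^sup>+y. f y \<partial>lebesgue_on (ball x e)) < \<infinity>"
  shows "(\<integral>\<^sup>+x. f x \<partial>lebesgue_on C) < \<infinity>"
proof -
  obtain e where e: "\<And>x. x \<in> C \<Longrightarrow> 0 < e x" "\<And>x. x \<in> C \<Longrightarrow> ball x (e x) \<subseteq> D"
    "\<And>x. x \<in> C \<Longrightarrow> (\<integral>\<^sup>+y. f y \<partial>lebesgue_on (ball x (e x))) < \<infinity>"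
    using loc by metis
  have cover: "C \<subseteq> (\<Union>x\<in>C. ball x (e x))"
    using e(1) by force
  obtain T where T: "T \<subseteq> C" "finite T" "C \<subseteq> (\<Union>x\<in>T. ball x (e x))"
    by (rule compactE_image[OF C _ cover]) (simp, blast)
  have meas: "(\<lambda>y. f y * indicator (ball x (e x)) y) \<in> borel_measurable lebesgue" if "x \<in> T" for x
  proof -
    have "f \<in> borel_measurable (lebesgue_on (ball x (e x)))"
      using that T e(2) by (intro measurable_restrict_mono[OF f]) auto
    then show ?thesis
      by (simp add: borel_measurable_restrict_space_iff_ennreal)
  qed
  have "(\<integral>\<^sup>+x. f x \<partial>lebesgue_on C) = (\<integral>\<^sup>+y. f y * indicator C y \<partial>lebesgue)"
    using C by (simp add: nn_integral_restrict_space lmeasurable_compact fmeasurableD)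
  also have "\<dots> \<le> (\<integral>\<^sup>+y. (\<Sum>x\<in>T. f y * indicator (ball x (e x)) y) \<partial>lebesgue)"
  proof (intro nn_integral_mono)
    fix y
    show "f y * indicator C y \<le> (\<Sum>x\<in>T. f y * indicator (ball x (e x)) y)"
    proof (cases "y \<in> C")
      case True
      then obtain x where x: "x \<in> T" "y \<in> ball x (e x)"
        using T by blast
      have "f y * indicator C y = f y * indicator (ball x (e x)) y"
        using True x by simp
      also have "\<dots> \<le> (\<Sum>x\<in>T. f y * indicator (ball x (e x)) y)"
        using x T by (intro member_le_sum) auto
      finally show ?thesis .
    qed simp
  qed
  also have "\<dots> = (\<Sum>x\<in>T. \<integral>\<^sup>+y. f y * indicator (ball x (e x)) y \<partial>lebesgue)"
    by (intro nn_integral_sum meas)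
  also have "\<dots> = (\<Sum>x\<in>T. \<integral>\<^sup>+y. f y \<partial>lebesgue_on (ball x (e x)))"
    by (simp add: nn_integral_restrict_space)
  also have "\<dots> < \<infinity>"
    using T e(3) by (auto simp: subset_iff)
  finally show ?thesis .
qed

lemma locally_integrable_AE_finite:
  fixes u :: "'a::euclidean_space \<Rightarrow> ereal"
  assumes u: "locally_integrable D u" and "open D"
  shows "AE x in lebesgue_on D. \<bar>u x\<bar> \<noteq> \<infinity>"
proof -
  obtain C where C: "\<And>n::nat. compact (C n)" "\<And>n. C n \<subseteq> D" "\<Union>(range C) = D"
    using open_Union_compact_subsets[OF \<open>open D\<close>] by metis
  have "AE x in lebesgue. x \<in> C n \<longrightarrow> \<bar>u x\<bar> \<noteq> \<infinity>" for n
  proof -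
    have [measurable]: "u \<in> borel_measurable (lebesgue_on (C n))"
      using u C by (auto simp: locally_integrable_def intro: measurable_restrict_mono)
    have "AE x in lebesgue_on (C n). e2ennreal \<bar>u x\<bar> \<noteq> \<infinity>"
      using u C by (intro nn_integral_PInf_AE) (auto simp: locally_integrable_def less_top)
    then have "AE x in lebesgue_on (C n). \<bar>u x\<bar> \<noteq> \<infinity>"
      by (rule AE_mp) auto
    then show ?thesis
      using C by (simp add: AE_restrict_space_iff lmeasurable_compact fmeasurableD)
  qed
  then have "AE x in lebesgue. \<forall>n. x \<in> C n \<longrightarrow> \<bar>u x\<bar> \<noteq> \<infinity>"
    unfolding AE_all_countable by blast
  then have "AE x in lebesgue. x \<in> D \<longrightarrow> \<bar>u x\<bar> \<noteq> \<infinity>"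
    by (rule AE_mp) (use C(3) in auto)
  then show ?thesis
    using \<open>open D\<close> by (simp add: AE_restrict_space_iff)
qed

lemma K_qns_ns_minus_infty_or_locally_integrable:
  fixes u :: "'a::euclidean_space \<Rightarrow> ereal"
  assumes u: "K_qns_ns K D u" and K: "0 < K" and D: "open D" "connected D"
  shows "(\<forall>x\<in>D. u x = -\<infinity>) \<or> locally_integrable D u"
proof -
  have adm: "admissible D u"
    using u by (simp add: K_qns_ns_def)
  \<comment> \<open>\<open>G\<close>: integrability near the point; \<open>H\<close>: constant value \<open>-\<infinity>\<close> near the point. These two open sets partition the connected set \<open>D\<close>.\<close>
  define G where "G = {x\<in>D. \<exists>e>0. ball x e \<subseteq> D \<and> (\<integral>\<^sup>+y. e2ennreal \<bar>u y\<bar> \<partial>lebesgue_on (ball x e)) < \<infinity>}"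
  define H where "H = {x\<in>D. \<exists>e>0. \<forall>y\<in>ball x e. u y = -\<infinity>}"
  have "open G"
    unfolding open_contains_ball
  proof
    fix x assume "x \<in> G"
    then obtain e where e: "0 < e" "ball x e \<subseteq> D" "(\<integral>\<^sup>+y. e2ennreal \<bar>u y\<bar> \<partial>lebesgue_on (ball x e)) < \<infinity>"
      by (auto simp: G_def)
    have "z \<in> G" if z: "z \<in> ball x e" for z
    proof -
      obtain d where d: "0 < d" "ball z d \<subseteq> ball x e"
        using z open_ball open_contains_ball by blast
      have "(\<integral>\<^sup>+y. e2ennreal \<bar>u y\<bar> \<partial>lebesgue_on (ball z d)) \<le> (\<integral>\<^sup>+y. e2ennreal \<bar>u y\<bar> \<partial>lebesgue_on (ball x e))"
        using d by (intro nn_integral_lebesgue_on_mono_set) auto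
      also note e(3)
      finally show ?thesis
        using d z e(2) unfolding G_def by blast
    qed
    with e show "\<exists>e>0. ball x e \<subseteq> G"
      by blast
  qed
  moreover have "open H"
    unfolding open_contains_ball
  proof
    fix x assume "x \<in> H"
    then obtain e where e: "0 < e" "\<forall>y\<in>ball x e. u y = -\<infinity>" "x \<in> D"
      by (auto simp: H_def)
    then have "open (D \<inter> ball x e)" "x \<in> D \<inter> ball x e"
      using D by auto
    then obtain d where d: "0 < d" "ball x d \<subseteq> D \<inter> ball x e"
      using open_contains_ball by blast
    have "ball x d \<subseteq> H"
    proof
      fix z assume z: "z \<in> ball x d"
      obtain d' where "0 < d'" "ball z d' \<subseteq> ball x d"
        using z open_ball open_contains_ball by blast
      then show "z \<in> H"
        using z d e unfolding H_def by blast
    qed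
    with d show "\<exists>e>0. ball x e \<subseteq> H"
      by blast
  qed
  moreover have "D \<subseteq> G \<union> H"
  proof
    fix x assume x: "x \<in> D"
    then obtain R where R: "0 < R" "ball x R \<subseteq> D"
      using D open_contains_ball by blast
    \<comment> \<open>The centre \<open>y\<close> found below lies within \<open>r\<close> of \<open>x\<close>, so \<open>cball y r\<close> stays within \<open>2 * r < R\<close> of \<open>x\<close> and \<open>ball y r\<close> contains \<open>x\<close>.\<close>
    define r where "r = R / 3"
    have r: "0 < r"
      using R by (simp add: r_def)
    show "x \<in> G \<union> H"
    proof (cases "\<forall>y\<in>ball x r. u y = -\<infinity>")
      case True
      with x r show ?thesis
        by (auto simp: H_def)
    next
      case False
      then obtain y where y: "dist x y < r" "u y \<noteq> -\<infinity>"
        by auto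
      have "cball y r \<subseteq> ball x R"
        using y r by (subst cball_subset_ball_iff) (simp add: r_def dist_commute)
      with R have "(\<integral>\<^sup>+z. e2ennreal \<bar>u z\<bar> \<partial>lebesgue_on (ball y r)) < \<infinity>"
        by (intro K_qns_ns_integrable_ball[OF u K r _ y(2)]) auto
      moreover have "x \<in> ball y r"
        using y(1) by (simp add: dist_commute)
      then obtain d where "0 < d" "ball x d \<subseteq> ball y r"
        using open_ball open_contains_ball by blast
      moreover have "ball y r \<subseteq> D"
        using \<open>cball y r \<subseteq> ball x R\<close> R ball_subset_cball by blast
      ultimately have "(\<integral>\<^sup>+z. e2ennreal \<bar>u z\<bar> \<partial>lebesgue_on (ball x d)) < \<infinity>" "ball x d \<subseteq> D" "0 < d"
        using order.strict_trans1[OF nn_integral_lebesgue_on_mono_set[of "ball x d" "ball y r" "\<lambda>z. e2ennreal \<bar>u z\<bar>"]]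
        by auto
      with x show ?thesis
        unfolding G_def by blast
    qed
  qed
  moreover have "G \<inter> H \<inter> D = {}"
  proof -
    have False if "x \<in> G" "x \<in> H" for x
    proof -
      obtain e where e: "0 < e" "(\<integral>\<^sup>+y. e2ennreal \<bar>u y\<bar> \<partial>lebesgue_on (ball x e)) < \<infinity>"
        using \<open>x \<in> G\<close> unfolding G_def by blast
      obtain d where d: "0 < d" "\<forall>y\<in>ball x d. u y = -\<infinity>"
        using \<open>x \<in> H\<close> unfolding H_def by blast
      define m where "m = min d e"
      have m: "0 < m" "m \<le> d" "m \<le> e"
        using d e by (auto simp: m_def)
      have "emeasure lebesgue (ball x m) \<noteq> 0"
        using m by (simp add: emeasure_ball ennreal_eq_0_iff not_le)
      then have "\<infinity> = (\<integral>\<^sup>+y. \<infinity> \<partial>lebesgue_on (ball x m))"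
        by (simp add: emeasure_restrict_space ennreal_top_mult)
      also have "\<dots> = (\<integral>\<^sup>+y. e2ennreal \<bar>u y\<bar> \<partial>lebesgue_on (ball x m))"
        using d m by (intro nn_integral_cong) auto
      also have "\<dots> \<le> (\<integral>\<^sup>+y. e2ennreal \<bar>u y\<bar> \<partial>lebesgue_on (ball x e))"
        using m by (intro nn_integral_lebesgue_on_mono_set) auto
      finally show False
        using e by simp
    qed
    then show ?thesis
      by blast
  qed
  ultimately have "G \<inter> D = {} \<or> H \<inter> D = {}"
    using connectedD[OF \<open>connected D\<close>] by blast
  then show ?thesis
  proof
    assume "G \<inter> D = {}"
    with \<open>D \<subseteq> G \<union> H\<close> have "D \<subseteq> H"
      by blast
    then show ?thesis
      by (force simp: H_def)
  next
    assume "H \<inter> D = {}"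
    with \<open>D \<subseteq> G \<union> H\<close> have DG: "D \<subseteq> G"
      by blast
    have meas [measurable]: "u \<in> borel_measurable (lebesgue_on D)"
      using adm by (simp add: admissible_def)
    have "(\<integral>\<^sup>+x. e2ennreal \<bar>u x\<bar> \<partial>lebesgue_on C) < \<infinity>" if "compact C" "C \<subseteq> D" for C
      using that DG by (intro nn_integral_compact_less_infty[where D = D]) (measurable, auto simp: G_def)
    then show ?thesis
      using meas by (simp add: locally_integrable_def)
  qed
qed

section \<open>Basic properties of quasi-nearly subharmonic functions\<close>

theorem proposition2:
  fixes D :: "'a::euclidean_space set" and K K1 K2 :: real
  assumes "DIM('a) \<ge> 2"
    and "open D" and "connected D" and "D \<noteq> {}"
    and "K \<ge> 1" and "K1 \<ge> 1" and "K2 \<ge> 1"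
  shows
    \<comment> \<open>(i)\<close>
    "(\<forall>u. K_qns K1 D u \<and> K2 \<ge> K1 \<longrightarrow> K_qns K2 D u)
    \<and> \<comment> \<open>(ii)\<close>
    (\<forall>u1 u2. K_qns_ns K D u1 \<and> K_qns_ns K D u2 \<longrightarrow>
       (\<forall>a b :: real. a \<ge> 0 \<and> b \<ge> 0 \<longrightarrow> K_qns_ns K D (\<lambda>x. ereal a * u1 x + ereal b * u2 x)))
    \<and> \<comment> \<open>(iii)\<close>
    (\<forall>u. quasi_nearly_subharmonic D u \<longrightarrow> locally_bounded_above D u)
    \<and> \<comment> \<open>(iv)\<close>
    (\<forall>(v :: nat \<Rightarrow> 'a \<Rightarrow> ereal) u.
       (\<forall>x\<in>D. decseq (\<lambda>j. v j x) \<and> (\<lambda>j. v j x) \<longlonglongrightarrow> u x) \<longrightarrow>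
         ((\<forall>j. K_qns K D (v j)) \<longrightarrow> K_qns K D u) \<and>
         ((\<forall>j. K_qns_ns K D (v j)) \<longrightarrow> K_qns_ns K D u))
    \<and> \<comment> \<open>(v)\<close>
    (\<forall>u v. K_qns K1 D u \<and> K_qns K2 D v \<longrightarrow> K_qns (max K1 K2) D (\<lambda>x. max (u x) (v x)))
    \<and> (\<forall>u. K_qns K1 D u \<longrightarrow> K_qns K1 D (pos_part u))
    \<and> \<comment> \<open>(vi)\<close>
    (\<forall>(F :: ('a \<Rightarrow> ereal) set) w.
       w = (\<lambda>x. SUP u\<in>F. u x) \<and>
       w \<in> borel_measurable (lebesgue_on D) \<and> locally_integrable D (pos_part w) \<longrightarrow>
         ((\<forall>u\<in>F. K_qns K D u) \<longrightarrow> K_qns K D w) \<and>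
         ((\<forall>u\<in>F. K_qns_ns K D u) \<longrightarrow> K_qns_ns K D w))
    \<and> \<comment> \<open>(vii)\<close>
    (\<forall>u. quasi_nearly_subharmonic_ns D u \<longrightarrow>
       (\<forall>x\<in>D. u x = -\<infinity>) \<or>
       ((AE x in lebesgue_on D. \<bar>u x\<bar> \<noteq> \<infinity>) \<and> locally_integrable D u))"
proof (intro conjI)
  have pos: "0 \<le> K" "0 \<le> K1" "0 \<le> K2"
    using assms by auto
  show "\<forall>u. K_qns K1 D u \<and> K2 \<ge> K1 \<longrightarrow> K_qns K2 D u"
    using K_qns_constant_mono by blast
  show "\<forall>u1 u2. K_qns_ns K D u1 \<and> K_qns_ns K D u2 \<longrightarrow>
      (\<forall>a b :: real. a \<ge> 0 \<and> b \<ge> 0 \<longrightarrow> K_qns_ns K D (\<lambda>x. ereal a * u1 x + ereal b * u2 x))"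
    using pos(1) by (blast intro: K_qns_ns_linear_combination)
  show "\<forall>u. quasi_nearly_subharmonic D u \<longrightarrow> locally_bounded_above D u"
    unfolding quasi_nearly_subharmonic_def
    using K_qns_locally_bounded_above \<open>open D\<close> by (metis order_trans zero_le_one)
  show "\<forall>(v :: nat \<Rightarrow> 'a \<Rightarrow> ereal) u.
      (\<forall>x\<in>D. decseq (\<lambda>j. v j x) \<and> (\<lambda>j. v j x) \<longlonglongrightarrow> u x) \<longrightarrow>
        ((\<forall>j. K_qns K D (v j)) \<longrightarrow> K_qns K D u) \<and>
        ((\<forall>j. K_qns_ns K D (v j)) \<longrightarrow> K_qns_ns K D u)"
  proof (intro allI impI conjI)
    fix v :: "nat \<Rightarrow> 'a \<Rightarrow> ereal" and u
    assume lim: "\<forall>x\<in>D. decseq (\<lambda>j. v j x) \<and> (\<lambda>j. v j x) \<longlonglongrightarrow> u x"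
    show "K_qns K D u" if "\<forall>j. K_qns K D (v j)"
      by (rule K_qns_decreasing_limit[where v = v]) (use that lim in auto)
    show "K_qns_ns K D u" if "\<forall>j. K_qns_ns K D (v j)"
      by (rule K_qns_ns_decreasing_limit[where v = v]) (use that lim in auto)
  qed
  show "\<forall>u v. K_qns K1 D u \<and> K_qns K2 D v \<longrightarrow> K_qns (max K1 K2) D (\<lambda>x. max (u x) (v x))"
    using K_qns_max pos(2,3) by blast
  show "\<forall>u. K_qns K1 D u \<longrightarrow> K_qns K1 D (pos_part u)"
    using K_qns_pos_part \<open>K1 \<ge> 1\<close> by blast
  show "\<forall>(F :: ('a \<Rightarrow> ereal) set) w.
      w = (\<lambda>x. SUP u\<in>F. u x) \<and>
      w \<in> borel_measurable (lebesgue_on D) \<and> locally_integrable D (pos_part w) \<longrightarrow>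
        ((\<forall>u\<in>F. K_qns K D u) \<longrightarrow> K_qns K D w) \<and>
        ((\<forall>u\<in>F. K_qns_ns K D u) \<longrightarrow> K_qns_ns K D w)"
  proof (intro allI impI conjI; elim conjE)
    fix F :: "('a \<Rightarrow> ereal) set" and w
    assume w: "w = (\<lambda>x. SUP u\<in>F. u x)" "w \<in> borel_measurable (lebesgue_on D)"
      "locally_integrable D (pos_part w)"
    show "K_qns K D w" if "\<forall>u\<in>F. K_qns K D u"
      using K_qns_SUP[OF w \<open>open D\<close> pos(1)] that by blast
    show "K_qns_ns K D w" if "\<forall>u\<in>F. K_qns_ns K D u"
      using K_qns_ns_SUP[OF w \<open>open D\<close> pos(1)] that by blast
  qed
  show "\<forall>u. quasi_nearly_subharmonic_ns D u \<longrightarrow>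
      (\<forall>x\<in>D. u x = -\<infinity>) \<or>
      ((AE x in lebesgue_on D. \<bar>u x\<bar> \<noteq> \<infinity>) \<and> locally_integrable D u)"
  proof (intro allI impI)
    fix u assume "quasi_nearly_subharmonic_ns D u"
    then obtain L where "1 \<le> L" "K_qns_ns L D u"
      by (auto simp: quasi_nearly_subharmonic_ns_def)
    then have "(\<forall>x\<in>D. u x = -\<infinity>) \<or> locally_integrable D u"
      using assms by (intro K_qns_ns_minus_infty_or_locally_integrable) auto
    then show "(\<forall>x\<in>D. u x = -\<infinity>) \<or>
        ((AE x in lebesgue_on D. \<bar>u x\<bar> \<noteq> \<infinity>) \<and> locally_integrable D u)"
      using locally_integrable_AE_finite \<open>open D\<close> by blast
  qed
qed

end
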